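(* Let $M$ be a screen transversal Cauchy Riemann (STCR) lightlike submanifold of an indefinite Kähler manifold $\bar M$, with associated decomposition $Rad(TM)=D_1\oplus D_2$, $\bar J(D_1)\subset S(TM)$, $\bar J(D_2)\subset S(TM^\perp)$. Then $M$ is a CR-lightlike submanifold if and only if $D_2=\{0\}$; and $M$ is a screen transversal lightlike submanifold if and only if $D_1=\{0\}$.
   Context: Indefinite Kähler manifold $(\bar M,\bar J,\bar g)$: a semi-Riemannian manifold of constant index $q$, $0<q<\dim\bar M$, with an almost complex structure $\bar J$ ($\bar J^2=-I$) satisfying $\bar g(\bar JX,\bar JY)=\bar g(X,Y)$ and $\bar\nabla\bar J=0$, where $\bar\nabla$ is the Levi-Civita connection of $\bar g$. Lightlike submanifold: a submanifold $M$ of dimension $m$ of $\bar M$ (of dimension $m+n$), with induced metric $g$, such that $Rad(TM)=TM\cap TM^\perp$ has constant rank $r$, $1\le r\le m$. One fixes non-degenerate complements: a screen distribution $S(TM)$ with $TM=S(TM)\perp Rad(TM)$ and a screen transversal bundle $S(TM^\perp)$ with $TM^\perp=S(TM^\perp)\perp Rad(TM)$. The lightlike transversal bundle $ltr(TM)$ is a rank $r$ complement of $Rad(TM)$ in the orthogonal complement of $S(TM)\perp S(TM^\perp)$ in $T\bar M|_M$, locally spanned by $N_1,\dots,N_r$ with $\bar g(\xi_i,N_j)=\delta_{ij}$, $\bar g(N_i,N_j)=0$ for a local basis $\{\xi_i\}$ of $Rad(TM)$. Put $tr(TM)=ltr(TM)\perp S(TM^\perp)$; then $T\bar M|_M=TM\oplus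 tr(TM)$. STCR lightlike submanifold: a real lightlike submanifold $M$ of $\bar M$ such that (A) there are subbundles $D_1,D_2$ of $Rad(TM)$ with $Rad(TM)=D_1\oplus D_2$, $\bar J(D_1)\subset S(TM)$, $\bar J(D_2)\subset S(TM^\perp)$; (B) there are subbundles $D_0,D'$ of $S(TM)$ with $S(TM)=\{\bar JD_1\oplus D'\}\perp D_0$, $\bar J(D_0)=D_0$, $\bar J(D')=L_1\perp S$, where $D_0$ is non-degenerate and $L_1$, $S$ are vector subbundles of $ltr(TM)$ and $S(TM^\perp)$ respectively. CR-lightlike submanifold (Duggal–Bejancu): a real lightlike submanifold such that $\bar J(Rad(TM))$ is a distribution on $M$ with $Rad(TM)\cap\bar J(Rad(TM))=\{0\}$, and there are bundles $S(TM)$, $S(TM^\perp)$, $ltr(TM)$, $D_0$, $D'$ with $S(TM)=\{\bar J(Rad(TM))\oplus D'\}\perp D_0$, $\bar J(D_0)=D_0$, $\bar J(D')=ltr(TM)\perp S$, where $D_0$ is non-degenerate and $S$ is a vector subbundle of $S(TM^\perp)$. Screen transversal lightlike submanifold (Şahin): a lightlike submanifold with a screen transversal bundle $S(TM^\perp)$ such that $\bar J(Rad(TM))\subset S(TM^\perp)$. Here "CR-lightlike" and "screen transversal lightlike" refer to the given bundles $S(TM)$, $S(TM^\perp)$, $ltr(TM)$ of the STCR structure. *)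

theory Defs
  imports "HOL-Analysis.Analysis"
begin

section \<open>Smooth manifolds\<close>

text \<open>
  Of class C^k, by iterated directional derivatives. Only meant for open sets U: derivatives are
  taken in the whole space, and all uses below are on open sets.
\<close>

primrec Ck_on :: "nat \<Rightarrow> 'u::euclidean_space set \<Rightarrow> ('u \<Rightarrow> 'v::real_normed_vector) \<Rightarrow> bool" where
  "Ck_on 0 U F \<longleftrightarrow> continuous_on U F"
| "Ck_on (Suc k) U F \<longleftrightarrow>
     (\<forall>x\<in>U. F differentiable (at x)) \<and>
     (\<forall>v. Ck_on k U (\<lambda>x. frechet_derivative F (at x) v))"

definition smooth_on :: "'u::euclidean_space set \<Rightarrow> ('u \<Rightarrow> 'v::real_normed_vector) \<Rightarrow> bool" where
  "smooth_on U F \<longleftrightarrow> (\<forall>k. Ck_on k U F)"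

text \<open>A chart is a pair of its domain and its coordinate map (irrelevant outside the domain).\<close>

type_synonym ('p, 'e) chart = "'p set \<times> ('p \<Rightarrow> 'e)"

definition chart_inv :: "('p, 'e) chart \<Rightarrow> 'e \<Rightarrow> 'p" where
  "chart_inv c = inv_into (fst c) (snd c)"

text \<open>
  A manifold is a Hausdorff, second countable type with a smooth atlas. Its dimension is the
  dimension of the model space.
\<close>

definition smooth_atlas ::
  "('p::{t2_space,second_countable_topology}, 'e::euclidean_space) chart set \<Rightarrow> bool" where
  "smooth_atlas A \<longleftrightarrow>
     (\<forall>c\<in>A. open (fst c) \<and> open (snd c ` fst c) \<and>
            homeomorphism (fst c) (snd c ` fst c) (snd c) (chart_inv c)) \<and>
     (\<Union>c\<in>A. fst c) = UNIV \<and>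
     (\<forall>c\<in>A. \<forall>d\<in>A. smooth_on (snd c ` (fst c \<inter> fst d)) (snd d \<circ> chart_inv c))"

definition smooth_fun ::
  "('p, 'e::euclidean_space) chart set \<Rightarrow> ('p \<Rightarrow> real) \<Rightarrow> bool" where
  "smooth_fun A h \<longleftrightarrow> (\<forall>c\<in>A. smooth_on (snd c ` fst c) (h \<circ> chart_inv c))"

definition smooth_map ::
  "('m::topological_space, 'h::euclidean_space) chart set \<Rightarrow>
   ('p::topological_space, 'e::euclidean_space) chart set \<Rightarrow> ('m \<Rightarrow> 'p) \<Rightarrow> bool" where
  "smooth_map A B f \<longleftrightarrow> continuous_on UNIV f \<and>
     (\<forall>c\<in>A. \<forall>d\<in>B. smooth_on (snd c ` (fst c \<inter> f -` fst d)) (snd d \<circ> f \<circ> chart_inv c))"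


section \<open>Tangent vectors\<close>

text \<open>
  The tangent space at a point p is identified with the model space by means of one chart
  around p, selected once and for all. Hence a tangent vector at p is an element of the model space,
  read in the chart \<open>chart_at A p\<close>; the selected chart may jump from point to point, and smoothness
  of fields of tangent vectors is therefore always expressed through their components in a fixed
  chart of the atlas.
\<close>

definition chart_at :: "('p, 'e) chart set \<Rightarrow> 'p \<Rightarrow> ('p, 'e) chart" where
  "chart_at A p = (SOME c. c \<in> A \<and> p \<in> fst c)"

text \<open>Components in the chart c of a tangent vector v at p.\<close>

definition comps ::
  "('p, 'e::euclidean_space) chart set \<Rightarrow> ('p, 'e) chart \<Rightarrow> 'p \<Rightarrow> 'e \<Rightarrow> 'e" where
  "comps A c p v =
     frechet_derivative (snd c \<circ> chart_inv (chart_at A p)) (at (snd (chart_at A p) p)) v"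

text \<open>The tangent vector at p whose components in the chart c are u.\<close>

definition coord_vec ::
  "('p, 'e::euclidean_space) chart set \<Rightarrow> ('p, 'e) chart \<Rightarrow> 'e \<Rightarrow> 'p \<Rightarrow> 'e" where
  "coord_vec A c u p =
     frechet_derivative (snd (chart_at A p) \<circ> chart_inv c) (at (snd c p)) u"

definition tangent_map ::
  "('m, 'h::euclidean_space) chart set \<Rightarrow> ('p, 'e::euclidean_space) chart set \<Rightarrow>
   ('m \<Rightarrow> 'p) \<Rightarrow> 'm \<Rightarrow> 'h \<Rightarrow> 'e" where
  "tangent_map A B f p =
     frechet_derivative (snd (chart_at B (f p)) \<circ> f \<circ> chart_inv (chart_at A p))
       (at (snd (chart_at A p) p))"

text \<open>
  Smoothness on the open set W of a vector field X along f, that is, of a section of the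
  pullback by f of the tangent bundle of the target: X p is a tangent vector at f p.
\<close>

definition smooth_along ::
  "('m, 'h::euclidean_space) chart set \<Rightarrow> ('p, 'e::euclidean_space) chart set \<Rightarrow>
   ('m \<Rightarrow> 'p) \<Rightarrow> 'm set \<Rightarrow> ('m \<Rightarrow> 'e) \<Rightarrow> bool" where
  "smooth_along A B f W X \<longleftrightarrow>
     (\<forall>c\<in>A. \<forall>d\<in>B. smooth_on (snd c ` (fst c \<inter> W \<inter> f -` fst d))
        ((\<lambda>p. comps B d (f p) (X p)) \<circ> chart_inv c))"

definition smooth_field :: "('p, 'e::euclidean_space) chart set \<Rightarrow> ('p \<Rightarrow> 'e) \<Rightarrow> bool" where
  "smooth_field B X \<longleftrightarrow> smooth_along B B (\<lambda>p. p) UNIV X"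


section \<open>Subbundles along a map\<close>

definition frame_on ::
  "('m, 'h::euclidean_space) chart set \<Rightarrow> ('p, 'e::euclidean_space) chart set \<Rightarrow> ('m \<Rightarrow> 'p) \<Rightarrow>
   'm set \<Rightarrow> nat \<Rightarrow> ('m \<Rightarrow> 'e set) \<Rightarrow> (nat \<Rightarrow> 'm \<Rightarrow> 'e) \<Rightarrow> bool" where
  "frame_on A B f W k E X \<longleftrightarrow>
     (\<forall>i<k. smooth_along A B f W (X i)) \<and>
     (\<forall>p\<in>W. E p = span ((\<lambda>i. X i p) ` {..<k}) \<and> dim (E p) = k)"

text \<open>
  Smooth subbundles of rank k of the pullback by f of the tangent bundle of the target. Those
  contained in the image of the tangent map of an immersion f are the distributions on its source.
\<close>

definition subbundle_of_rank ::
  "('m::topological_space, 'h::euclidean_space) chart set \<Rightarrow>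
   ('p, 'e::euclidean_space) chart set \<Rightarrow> ('m \<Rightarrow> 'p) \<Rightarrow> nat \<Rightarrow> ('m \<Rightarrow> 'e set) \<Rightarrow> bool" where
  "subbundle_of_rank A B f k E \<longleftrightarrow>
     (\<forall>p. \<exists>W X. open W \<and> p \<in> W \<and> frame_on A B f W k E X)"

definition subbundle ::
  "('m::topological_space, 'h::euclidean_space) chart set \<Rightarrow>
   ('p, 'e::euclidean_space) chart set \<Rightarrow> ('m \<Rightarrow> 'p) \<Rightarrow> ('m \<Rightarrow> 'e set) \<Rightarrow> bool" where
  "subbundle A B f E \<longleftrightarrow> (\<exists>k. subbundle_of_rank A B f k E)"


section \<open>Linear algebra of a symmetric bilinear form\<close>

definition direct_sum :: "'e::real_vector set \<Rightarrow> 'e set \<Rightarrow> 'e set \<Rightarrow> bool" where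
  "direct_sum E F G \<longleftrightarrow> E = {x + y | x y. x \<in> F \<and> y \<in> G} \<and> F \<inter> G = {0}"

definition orth_sum ::
  "('e \<Rightarrow> 'e \<Rightarrow> real) \<Rightarrow> 'e::real_vector set \<Rightarrow> 'e set \<Rightarrow> 'e set \<Rightarrow> bool" where
  "orth_sum b E F G \<longleftrightarrow> direct_sum E F G \<and> (\<forall>x\<in>F. \<forall>y\<in>G. b x y = 0)"

definition orth_compl :: "('e \<Rightarrow> 'e \<Rightarrow> real) \<Rightarrow> 'e set \<Rightarrow> 'e set" where
  "orth_compl b F = {v. \<forall>w\<in>F. b v w = 0}"

definition nondeg_on :: "('e \<Rightarrow> 'e \<Rightarrow> real) \<Rightarrow> 'e::zero set \<Rightarrow> bool" where
  "nondeg_on b F \<longleftrightarrow> (\<forall>v\<in>F. (\<forall>w\<in>F. b v w = 0) \<longrightarrow> v = 0)"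

text \<open>The index: the largest dimension of a subspace on which b is negative definite.\<close>

definition form_index :: "('e::euclidean_space \<Rightarrow> 'e \<Rightarrow> real) \<Rightarrow> nat" where
  "form_index b = Max {dim V | V. subspace V \<and> (\<forall>v\<in>V. v \<noteq> 0 \<longrightarrow> b v v < 0)}"


section \<open>Indefinite Kaehler manifolds\<close>

definition semi_riemannian ::
  "('p::{t2_space,second_countable_topology}, 'e::euclidean_space) chart set \<Rightarrow>
   ('p \<Rightarrow> 'e \<Rightarrow> 'e \<Rightarrow> real) \<Rightarrow> nat \<Rightarrow> bool" where
  "semi_riemannian B g q \<longleftrightarrow>
     smooth_atlas B \<and>
     (\<forall>p. bilinear (g p) \<and> (\<forall>u v. g p u v = g p v u) \<and> nondeg_on (g p) UNIV \<and>
          form_index (g p) = q) \<and>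
     (\<forall>c\<in>B. \<forall>u v. smooth_on (snd c ` fst c)
        ((\<lambda>p. g p (coord_vec B c u p) (coord_vec B c v p)) \<circ> chart_inv c))"

definition almost_complex ::
  "('p, 'e::euclidean_space) chart set \<Rightarrow> ('p \<Rightarrow> 'e \<Rightarrow> 'e) \<Rightarrow> bool" where
  "almost_complex B J \<longleftrightarrow>
     (\<forall>p. linear (J p) \<and> (\<forall>v. J p (J p v) = - v)) \<and>
     (\<forall>c\<in>B. \<forall>u. smooth_on (snd c ` fst c)
        ((\<lambda>p. comps B c p (J p (coord_vec B c u p))) \<circ> chart_inv c))"

definition dir_deriv ::
  "('p, 'e::euclidean_space) chart set \<Rightarrow> ('p \<Rightarrow> 'e) \<Rightarrow> ('p \<Rightarrow> real) \<Rightarrow> 'p \<Rightarrow> real" where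
  "dir_deriv B X h p =
     frechet_derivative (h \<circ> chart_inv (chart_at B p)) (at (snd (chart_at B p) p)) (X p)"

definition local_rep ::
  "('p, 'e::euclidean_space) chart set \<Rightarrow> ('p, 'e) chart \<Rightarrow> ('p \<Rightarrow> 'e) \<Rightarrow> 'e \<Rightarrow> 'e" where
  "local_rep B c X = (\<lambda>p. comps B c p (X p)) \<circ> chart_inv c"

text \<open>
  The bracket is computed in the selected chart at p, where the components of X and Y at p itself
  are X p and Y p.
\<close>

definition lie_bracket ::
  "('p, 'e::euclidean_space) chart set \<Rightarrow> ('p \<Rightarrow> 'e) \<Rightarrow> ('p \<Rightarrow> 'e) \<Rightarrow> 'p \<Rightarrow> 'e" where
  "lie_bracket B X Y p =
     (let c = chart_at B p in
        frechet_derivative (local_rep B c Y) (at (snd c p)) (X p) -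
        frechet_derivative (local_rep B c X) (at (snd c p)) (Y p))"

definition affine_connection ::
  "('p, 'e::euclidean_space) chart set \<Rightarrow> (('p \<Rightarrow> 'e) \<Rightarrow> ('p \<Rightarrow> 'e) \<Rightarrow> 'p \<Rightarrow> 'e) \<Rightarrow> bool" where
  "affine_connection B nabla \<longleftrightarrow>
     (\<forall>X Y. smooth_field B X \<longrightarrow> smooth_field B Y \<longrightarrow> smooth_field B (nabla X Y)) \<and>
     (\<forall>X Y Z h p. smooth_field B X \<longrightarrow> smooth_field B Y \<longrightarrow> smooth_field B Z \<longrightarrow> smooth_fun B h \<longrightarrow>
        nabla (\<lambda>x. X x + Y x) Z p = nabla X Z p + nabla Y Z p \<and>
        nabla (\<lambda>x. h x *\<^sub>R X x) Z p = h p *\<^sub>R nabla X Z p \<and>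
        nabla X (\<lambda>x. Y x + Z x) p = nabla X Y p + nabla X Z p \<and>
        nabla X (\<lambda>x. h x *\<^sub>R Y x) p = dir_deriv B X h p *\<^sub>R Y p + h p *\<^sub>R nabla X Y p)"

definition levi_civita ::
  "('p, 'e::euclidean_space) chart set \<Rightarrow> ('p \<Rightarrow> 'e \<Rightarrow> 'e \<Rightarrow> real) \<Rightarrow>
   (('p \<Rightarrow> 'e) \<Rightarrow> ('p \<Rightarrow> 'e) \<Rightarrow> 'p \<Rightarrow> 'e) \<Rightarrow> bool" where
  "levi_civita B g nabla \<longleftrightarrow>
     affine_connection B nabla \<and>
     (\<forall>X Y Z p. smooth_field B X \<longrightarrow> smooth_field B Y \<longrightarrow> smooth_field B Z \<longrightarrow>
        nabla X Y p - nabla Y X p = lie_bracket B X Y p \<and>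
        dir_deriv B X (\<lambda>x. g x (Y x) (Z x)) p =
          g p (nabla X Y p) (Z p) + g p (Y p) (nabla X Z p))"

text \<open>
  The Levi-Civita connection exists and is unique, so the existential quantifier below just names it.
\<close>

definition indefinite_kaehler ::
  "('p::{t2_space,second_countable_topology}, 'e::euclidean_space) chart set \<Rightarrow>
   ('p \<Rightarrow> 'e \<Rightarrow> 'e \<Rightarrow> real) \<Rightarrow> ('p \<Rightarrow> 'e \<Rightarrow> 'e) \<Rightarrow> nat \<Rightarrow> bool" where
  "indefinite_kaehler B g J q \<longleftrightarrow>
     semi_riemannian B g q \<and> 0 < q \<and> q < DIM('e) \<and>
     almost_complex B J \<and>
     (\<forall>p u v. g p (J p u) (J p v) = g p u v) \<and>
     (\<exists>nabla. levi_civita B g nabla \<and>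
        (\<forall>X Y p. smooth_field B X \<longrightarrow> smooth_field B Y \<longrightarrow>
           nabla X (\<lambda>x. J x (Y x)) p = J p (nabla X Y p)))"


section \<open>Lightlike submanifolds\<close>

text \<open>
  A submanifold is given by a manifold with atlas A and an injective immersion f. All bundles over
  it are described by their fibres inside the tangent spaces of the ambient manifold at f p;
  in particular the tangent spaces of the submanifold are replaced by their images.
\<close>

definition submanifold ::
  "('m::{t2_space,second_countable_topology}, 'h::euclidean_space) chart set \<Rightarrow>
   ('p::{t2_space,second_countable_topology}, 'e::euclidean_space) chart set \<Rightarrow>
   ('m \<Rightarrow> 'p) \<Rightarrow> bool" where
  "submanifold A B f \<longleftrightarrow>
     smooth_atlas A \<and> smooth_map A B f \<and> inj f \<and> (\<forall>p. inj (tangent_map A B f p))"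

definition TM ::
  "('m, 'h::euclidean_space) chart set \<Rightarrow> ('p, 'e::euclidean_space) chart set \<Rightarrow>
   ('m \<Rightarrow> 'p) \<Rightarrow> 'm \<Rightarrow> 'e set" where
  "TM A B f p = range (tangent_map A B f p)"

definition TM_perp ::
  "('m, 'h::euclidean_space) chart set \<Rightarrow> ('p, 'e::euclidean_space) chart set \<Rightarrow>
   ('p \<Rightarrow> 'e \<Rightarrow> 'e \<Rightarrow> real) \<Rightarrow> ('m \<Rightarrow> 'p) \<Rightarrow> 'm \<Rightarrow> 'e set" where
  "TM_perp A B g f p = orth_compl (g (f p)) (TM A B f p)"

definition Rad ::
  "('m, 'h::euclidean_space) chart set \<Rightarrow> ('p, 'e::euclidean_space) chart set \<Rightarrow>
   ('p \<Rightarrow> 'e \<Rightarrow> 'e \<Rightarrow> real) \<Rightarrow> ('m \<Rightarrow> 'p) \<Rightarrow> 'm \<Rightarrow> 'e set" where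
  "Rad A B g f p = TM A B f p \<inter> TM_perp A B g f p"

definition lightlike_transversal ::
  "('m::topological_space, 'h::euclidean_space) chart set \<Rightarrow>
   ('p, 'e::euclidean_space) chart set \<Rightarrow> ('p \<Rightarrow> 'e \<Rightarrow> 'e \<Rightarrow> real) \<Rightarrow> ('m \<Rightarrow> 'p) \<Rightarrow> nat \<Rightarrow>
   ('m \<Rightarrow> 'e set) \<Rightarrow> ('m \<Rightarrow> 'e set) \<Rightarrow> ('m \<Rightarrow> 'e set) \<Rightarrow> bool" where
  "lightlike_transversal A B g f r STM STMperp ltr \<longleftrightarrow>
     subbundle_of_rank A B f r ltr \<and>
     (\<forall>p. direct_sum (orth_compl (g (f p)) (STM p \<union> STMperp p)) (Rad A B g f p) (ltr p)) \<and>
     (\<forall>p. \<exists>W \<xi> N. open W \<and> p \<in> W \<and>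
        frame_on A B f W r (Rad A B g f) \<xi> \<and> frame_on A B f W r ltr N \<and>
        (\<forall>x\<in>W. \<forall>i<r. \<forall>j<r.
           g (f x) (\<xi> i x) (N j x) = (if i = j then 1 else 0) \<and>
           g (f x) (N i x) (N j x) = 0))"

definition lightlike_submanifold ::
  "('m::{t2_space,second_countable_topology}, 'h::euclidean_space) chart set \<Rightarrow>
   ('p::{t2_space,second_countable_topology}, 'e::euclidean_space) chart set \<Rightarrow>
   ('p \<Rightarrow> 'e \<Rightarrow> 'e \<Rightarrow> real) \<Rightarrow> ('m \<Rightarrow> 'p) \<Rightarrow> nat \<Rightarrow>
   ('m \<Rightarrow> 'e set) \<Rightarrow> ('m \<Rightarrow> 'e set) \<Rightarrow> ('m \<Rightarrow> 'e set) \<Rightarrow> bool" where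
  "lightlike_submanifold A B g f r STM STMperp ltr \<longleftrightarrow>
     submanifold A B f \<and>
     1 \<le> r \<and> r \<le> DIM('h) \<and> (\<forall>p. dim (Rad A B g f p) = r) \<and>
     subbundle A B f STM \<and> subbundle A B f STMperp \<and>
     (\<forall>p. nondeg_on (g (f p)) (STM p) \<and> nondeg_on (g (f p)) (STMperp p) \<and>
          orth_sum (g (f p)) (TM A B f p) (STM p) (Rad A B g f p) \<and>
          orth_sum (g (f p)) (TM_perp A B g f p) (STMperp p) (Rad A B g f p)) \<and>
     lightlike_transversal A B g f r STM STMperp ltr"

definition stcr_lightlike ::
  "('m::{t2_space,second_countable_topology}, 'h::euclidean_space) chart set \<Rightarrow>
   ('p::{t2_space,second_countable_topology}, 'e::euclidean_space) chart set \<Rightarrow>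
   ('p \<Rightarrow> 'e \<Rightarrow> 'e \<Rightarrow> real) \<Rightarrow> ('p \<Rightarrow> 'e \<Rightarrow> 'e) \<Rightarrow> ('m \<Rightarrow> 'p) \<Rightarrow> nat \<Rightarrow>
   ('m \<Rightarrow> 'e set) \<Rightarrow> ('m \<Rightarrow> 'e set) \<Rightarrow> ('m \<Rightarrow> 'e set) \<Rightarrow>
   ('m \<Rightarrow> 'e set) \<Rightarrow> ('m \<Rightarrow> 'e set) \<Rightarrow> bool" where
  "stcr_lightlike A B g J f r STM STMperp ltr D1 D2 \<longleftrightarrow>
     lightlike_submanifold A B g f r STM STMperp ltr \<and>
     subbundle A B f D1 \<and> subbundle A B f D2 \<and>
     (\<forall>p. direct_sum (Rad A B g f p) (D1 p) (D2 p) \<and>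
          J (f p) ` D1 p \<subseteq> STM p \<and> J (f p) ` D2 p \<subseteq> STMperp p) \<and>
     (\<exists>D0 D' L1 S.
        subbundle A B f D0 \<and> subbundle A B f D' \<and> subbundle A B f L1 \<and> subbundle A B f S \<and>
        (\<forall>p. D0 p \<subseteq> STM p \<and> D' p \<subseteq> STM p \<and> L1 p \<subseteq> ltr p \<and> S p \<subseteq> STMperp p \<and>
             nondeg_on (g (f p)) (D0 p) \<and>
             (\<exists>E. direct_sum E (J (f p) ` D1 p) (D' p) \<and>
                  orth_sum (g (f p)) (STM p) E (D0 p)) \<and>
             J (f p) ` D0 p = D0 p \<and>
             orth_sum (g (f p)) (J (f p) ` D' p) (L1 p) (S p)))"

definition cr_lightlike ::
  "('m::{t2_space,second_countable_topology}, 'h::euclidean_space) chart set \<Rightarrow>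
   ('p::{t2_space,second_countable_topology}, 'e::euclidean_space) chart set \<Rightarrow>
   ('p \<Rightarrow> 'e \<Rightarrow> 'e \<Rightarrow> real) \<Rightarrow> ('p \<Rightarrow> 'e \<Rightarrow> 'e) \<Rightarrow> ('m \<Rightarrow> 'p) \<Rightarrow> nat \<Rightarrow>
   ('m \<Rightarrow> 'e set) \<Rightarrow> ('m \<Rightarrow> 'e set) \<Rightarrow> ('m \<Rightarrow> 'e set) \<Rightarrow> bool" where
  "cr_lightlike A B g J f r STM STMperp ltr \<longleftrightarrow>
     lightlike_submanifold A B g f r STM STMperp ltr \<and>
     subbundle A B f (\<lambda>p. J (f p) ` Rad A B g f p) \<and>
     (\<forall>p. J (f p) ` Rad A B g f p \<subseteq> TM A B f p \<and>
          Rad A B g f p \<inter> J (f p) ` Rad A B g f p = {0}) \<and>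
     (\<exists>D0 D' S.
        subbundle A B f D0 \<and> subbundle A B f D' \<and> subbundle A B f S \<and>
        (\<forall>p. D0 p \<subseteq> STM p \<and> D' p \<subseteq> STM p \<and> S p \<subseteq> STMperp p \<and>
             nondeg_on (g (f p)) (D0 p) \<and>
             (\<exists>E. direct_sum E (J (f p) ` Rad A B g f p) (D' p) \<and>
                  orth_sum (g (f p)) (STM p) E (D0 p)) \<and>
             J (f p) ` D0 p = D0 p \<and>
             orth_sum (g (f p)) (J (f p) ` D' p) (ltr p) (S p)))"

definition screen_transversal_lightlike ::
  "('m::{t2_space,second_countable_topology}, 'h::euclidean_space) chart set \<Rightarrow>
   ('p::{t2_space,second_countable_topology}, 'e::euclidean_space) chart set \<Rightarrow>
   ('p \<Rightarrow> 'e \<Rightarrow> 'e \<Rightarrow> real) \<Rightarrow> ('p \<Rightarrow> 'e \<Rightarrow> 'e) \<Rightarrow> ('m \<Rightarrow> 'p) \<Rightarrow> nat \<Rightarrow>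
   ('m \<Rightarrow> 'e set) \<Rightarrow> ('m \<Rightarrow> 'e set) \<Rightarrow> ('m \<Rightarrow> 'e set) \<Rightarrow> bool" where
  "screen_transversal_lightlike A B g J f r STM STMperp ltr \<longleftrightarrow>
     lightlike_submanifold A B g f r STM STMperp ltr \<and>
     (\<forall>p. J (f p) ` Rad A B g f p \<subseteq> STMperp p)"

end

theory Submission
  imports Defs
begin

text \<open>
  Since \<open>STM\<close> and \<open>STMperp\<close> meet \<open>Rad\<close> trivially, and \<open>TM \<inter> TM_perp = Rad\<close>, a vector of \<open>STMperp\<close> tangent
  to the submanifold vanishes; this kills \<open>J D2\<close> in the CR case and \<open>J D1\<close> in the screen transversal
  case. The converse for CR is not purely formal: one needs \<open>L1 = ltr\<close>, which follows from
  \<open>D1 = Rad\<close> and the non-degeneracy of \<open>STM\<close> by a dimension count, and the smoothness of \<open>J Rad\<close>.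
\<close>

section \<open>Calculus of functions of class C^k\<close>

text \<open>Derivatives at a point depend only on a neighbourhood, so openness of \<open>U\<close>
  lets agreement on \<open>U\<close> pass to all iterated derivatives.\<close>

lemma Ck_on_cong:
  assumes "open U" "\<And>x. x \<in> U \<Longrightarrow> F x = G x" "Ck_on k U F"
  shows "Ck_on k U G"
  using assms(2,3)
proof (induction k arbitrary: F G)
  case 0
  then show ?case by (simp cong: continuous_on_cong)
next
  case (Suc k)
  have d: "(G has_derivative frechet_derivative F (at x)) (at x)" if "x \<in> U" for x
  proof -
    have "(F has_derivative frechet_derivative F (at x)) (at x)"
      using Suc.prems that by (simp add: frechet_derivative_works)
    then show ?thesis
      using has_derivative_transform_within_open[OF _ assms(1) that] Suc.prems(1) by blast
  qed
  then have "frechet_derivative G (at x) = frechet_derivative F (at x)" if "x \<in> U" for x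
    using that frechet_derivative_at by metis
  then have "Ck_on k U (\<lambda>x. frechet_derivative G (at x) v)" for v
    using Suc.IH[of "\<lambda>x. frechet_derivative F (at x) v"] Suc.prems(2) by simp
  then show ?case
    using d by (auto simp: differentiable_def)
qed

lemma Ck_on_subset: "Ck_on k U F \<Longrightarrow> V \<subseteq> U \<Longrightarrow> Ck_on k V F"
  by (induction k arbitrary: F) (auto intro: continuous_on_subset)

text \<open>Introduction rule for explicitly computed derivatives: uniqueness of the derivative
  identifies \<open>F' x\<close> with \<open>frechet_derivative F (at x)\<close> on
  \<open>U\<close>.\<close>

lemma Ck_on_SucI:
  assumes "open U" "\<And>x. x \<in> U \<Longrightarrow> (F has_derivative F' x) (at x)"
    "\<And>v. Ck_on k U (\<lambda>x. F' x v)"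
  shows "Ck_on (Suc k) U F"
proof -
  have "F' x v = frechet_derivative F (at x) v" if "x \<in> U" for x v
    using assms(2)[OF that] frechet_derivative_at by metis
  then have "Ck_on k U (\<lambda>x. frechet_derivative F (at x) v)" for v
    by (rule Ck_on_cong[OF assms(1) _ assms(3)])
  then show ?thesis
    using assms(2) by (auto simp: differentiable_def)
qed

lemma Ck_on_has_derivative:
  "Ck_on (Suc k) U F \<Longrightarrow> x \<in> U \<Longrightarrow> (F has_derivative frechet_derivative F (at x)) (at x)"
  by (simp add: frechet_derivative_works)

lemma Ck_on_Suc_imp: "Ck_on (Suc k) U F \<Longrightarrow> Ck_on k U F"
proof (induction k arbitrary: F)
  case 0
  then show ?case
    by (auto intro!: continuous_at_imp_continuous_on differentiable_imp_continuous_within)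
next
  case (Suc k)
  then show ?case by (metis Ck_on.simps(2))
qed

lemma Ck_on_const: "Ck_on k U (\<lambda>x. c)"
  by (induction k arbitrary: c) auto

lemma Ck_on_add:
  assumes "open U"
  shows "Ck_on k U F \<Longrightarrow> Ck_on k U G \<Longrightarrow> Ck_on k U (\<lambda>x. F x + G x)"
proof (induction k arbitrary: F G)
  case 0
  then show ?case by (simp add: continuous_on_add)
next
  case (Suc k)
  show ?case
    using Ck_on_has_derivative[OF Suc.prems(1)] Ck_on_has_derivative[OF Suc.prems(2)]
    by (rule Ck_on_SucI[OF assms has_derivative_add]) (use Suc in auto)
qed

lemma Ck_on_sum:
  assumes "open U" "\<And>i. i \<in> I \<Longrightarrow> Ck_on k U (F i)"
  shows "Ck_on k U (\<lambda>x. \<Sum>i\<in>I. F i x)"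
  using assms(2)
  by (induction I rule: infinite_finite_induct) (simp_all add: Ck_on_const Ck_on_add assms(1))

lemma Ck_on_bounded_linear:
  assumes "open U" "bounded_linear L"
  shows "Ck_on k U F \<Longrightarrow> Ck_on k U (\<lambda>x. L (F x))"
proof (induction k arbitrary: F)
  case 0
  then show ?case using assms(2) by (simp add: bounded_linear.continuous_on)
next
  case (Suc k)
  show ?case
    using Ck_on_has_derivative[OF Suc.prems]
    by (rule Ck_on_SucI[OF assms(1) bounded_linear.has_derivative[OF assms(2)]])
       (use Suc in auto)
qed

lemma Ck_on_scaleR:
  assumes "open U"
  shows "Ck_on k U s \<Longrightarrow> Ck_on k U F \<Longrightarrow> Ck_on k U (\<lambda>x. s x *\<^sub>R F x)"
proof (induction k arbitrary: s F)
  case 0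
  then show ?case by (simp add: continuous_on_scaleR)
next
  case (Suc k)
  show ?case
    using Ck_on_has_derivative[OF Suc.prems(1)] Ck_on_has_derivative[OF Suc.prems(2)]
  proof (rule Ck_on_SucI[OF assms has_derivative_scaleR])
    \<comment> \<open>Each term of the Leibniz rule pairs a derivative of class C^k with an
      undifferentiated factor, whose order \<open>Ck_on_Suc_imp\<close> lowers from
      \<open>Suc k\<close> to \<open>k\<close>.\<close>
    fix v
    show "Ck_on k U (\<lambda>x. s x *\<^sub>R frechet_derivative F (at x) v
                       + frechet_derivative s (at x) v *\<^sub>R F x)"
      using Suc.prems Suc.prems[THEN Ck_on_Suc_imp] by (intro Ck_on_add assms Suc.IH) auto
  qed auto
qed

text \<open>Separates an operator from its argument. In the chain rule both vary with the point,
  while \<open>Ck_on\<close> only speaks of derivatives in fixed directions, here the basis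
  vectors.\<close>

lemma linear_expand:
  fixes L :: "'a::euclidean_space \<Rightarrow> 'b::real_vector"
  assumes "linear L"
  shows "L v = (\<Sum>b\<in>Basis. (v \<bullet> b) *\<^sub>R L b)"
proof -
  have "L v = L (\<Sum>b\<in>Basis. (v \<bullet> b) *\<^sub>R b)"
    by (simp add: euclidean_representation)
  then show ?thesis
    by (simp add: linear_sum[OF assms] linear_cmul[OF assms])
qed

lemma Ck_on_compose:
  fixes F :: "'v::euclidean_space \<Rightarrow> 'w::real_normed_vector" and G :: "'u::euclidean_space \<Rightarrow> 'v"
  assumes "open U" "open V" "G ` U \<subseteq> V"
  shows "Ck_on k V F \<Longrightarrow> Ck_on k U G \<Longrightarrow> Ck_on k U (\<lambda>x. F (G x))"
proof (induction k arbitrary: F)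
  case 0
  then show ?case using assms(3) by (auto intro: continuous_on_compose2)
next
  case (Suc k)
  let ?F' = "\<lambda>y. frechet_derivative F (at y)" and ?G' = "\<lambda>x. frechet_derivative G (at x)"
  have dF: "(F has_derivative ?F' (G x)) (at (G x))" if "x \<in> U" for x
    using Suc.prems(1) that assms(3) by (blast intro: Ck_on_has_derivative)
  have dG: "(G has_derivative ?G' x) (at x)" if "x \<in> U" for x
    using Suc.prems(2) that by (rule Ck_on_has_derivative)
  show ?case
  proof (rule Ck_on_SucI[OF assms(1)])
    show "((\<lambda>x. F (G x)) has_derivative (\<lambda>v. ?F' (G x) (?G' x v))) (at x)" if "x \<in> U" for x
      using has_derivative_compose[OF dG dF] that by blast
    fix v
    \<comment> \<open>The induction hypothesis applies to \<open>\<lambda>y. ?F' y b\<close> with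
      \<open>b\<close> fixed; the scalar coefficients are the coordinates of
      \<open>?G' x v\<close>.\<close>
    have "Ck_on k U (\<lambda>x. \<Sum>b\<in>Basis. (?G' x v \<bullet> b) *\<^sub>R ?F' (G x) b)"
      using Suc.prems Ck_on_Suc_imp[OF Suc.prems(2)]
      by (intro Ck_on_sum Ck_on_scaleR assms(1) Suc.IH
            Ck_on_bounded_linear[OF assms(1) bounded_linear_inner_left]) auto
    then show "Ck_on k U (\<lambda>x. ?F' (G x) (?G' x v))"
      by (rule Ck_on_cong[OF assms(1), rotated])
         (use dF has_derivative_linear in \<open>blast intro: linear_expand[symmetric]\<close>)
  qed
qed

lemma smooth_on_differentiable:
  "smooth_on U F \<Longrightarrow> x \<in> U \<Longrightarrow> F differentiable (at x)"
  unfolding smooth_on_def by (metis Ck_on.simps(2))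


section \<open>The action of an almost complex structure on subbundles\<close>

lemma chart_at:
  assumes "smooth_atlas A"
  shows "chart_at A p \<in> A" "p \<in> fst (chart_at A p)"
proof -
  have "\<exists>c. c \<in> A \<and> p \<in> fst c"
    using assms unfolding smooth_atlas_def by blast
  from someI_ex[OF this] show "chart_at A p \<in> A" "p \<in> fst (chart_at A p)"
    unfolding chart_at_def by auto
qed

lemma chart_inv_chart:
  assumes "smooth_atlas A" "c \<in> A" "p \<in> fst c"
  shows "chart_inv c (snd c p) = p"
  using assms unfolding smooth_atlas_def homeomorphism_def by auto

text \<open>A chart is a homeomorphism onto an open set, so openness relative to its image is
  openness in the model space. This supplies the open domains that the C^k calculus
  requires.\<close>

lemma open_chart_image:
  assumes "smooth_atlas A" "c \<in> A" "open W" "W \<subseteq> fst c"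
  shows "open (snd c ` W)"
proof -
  have h: "homeomorphism (fst c) (snd c ` fst c) (snd c) (chart_inv c)"
    and o: "open (snd c ` fst c)"
    using assms(1,2) unfolding smooth_atlas_def by auto
  have "openin (top_of_set (fst c)) W"
    using assms(3,4) by (simp add: openin_open_eq open_subset)
  then have "openin (top_of_set (snd c ` fst c)) (snd c ` W)"
    using homeomorphism_imp_open_map[OF h] by blast
  then show ?thesis
    using o openin_open_trans by blast
qed

lemma transition_has_derivative:
  assumes "smooth_atlas B" "c \<in> B" "d \<in> B" "p \<in> fst c" "p \<in> fst d"
  shows "((snd d \<circ> chart_inv c) has_derivative
           frechet_derivative (snd d \<circ> chart_inv c) (at (snd c p))) (at (snd c p))"
proof -
  have "smooth_on (snd c ` (fst c \<inter> fst d)) (snd d \<circ> chart_inv c)"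
    using assms unfolding smooth_atlas_def by blast
  then show ?thesis
    using assms(4,5) unfolding frechet_derivative_works[symmetric]
    by (blast intro: smooth_on_differentiable)
qed

text \<open>The two transition maps compose to the identity on the open set \<open>?U\<close>, so by
  the chain rule and uniqueness of derivatives their derivatives compose to the identity.\<close>

lemma transition_inverse:
  assumes "smooth_atlas B" "c \<in> B" "d \<in> B" "p \<in> fst c" "p \<in> fst d"
  shows "frechet_derivative (snd c \<circ> chart_inv d) (at (snd d p))
           (frechet_derivative (snd d \<circ> chart_inv c) (at (snd c p)) v) = v"
proof -
  let ?F = "snd d \<circ> chart_inv c" and ?G = "snd c \<circ> chart_inv d"
  let ?U = "snd c ` (fst c \<inter> fst d)"
  have e: "?F (snd c p) = snd d p"
    using chart_inv_chart[OF assms(1,2,4)] by simp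
  have "((?G \<circ> ?F) has_derivative
          (frechet_derivative ?G (at (snd d p)) \<circ> frechet_derivative ?F (at (snd c p))))
          (at (snd c p))"
    using transition_has_derivative[OF assms]
      transition_has_derivative[OF assms(1,3,2,5,4)] e
    by (intro diff_chain_at) auto
  moreover have "open (fst c)" "open (fst d)"
    using assms unfolding smooth_atlas_def by auto
  then have "open ?U"
    using assms by (intro open_chart_image) auto
  moreover have "(?G \<circ> ?F) x = x" if "x \<in> ?U" for x
    using that chart_inv_chart[OF assms(1,2)] chart_inv_chart[OF assms(1,3)] by auto
  ultimately have "((\<lambda>x. x) has_derivative
      (frechet_derivative ?G (at (snd d p)) \<circ> frechet_derivative ?F (at (snd c p)))) (at (snd c p))"
    using assms by (elim has_derivative_transform_within_open) auto
  then have "frechet_derivative ?G (at (snd d p)) \<circ> frechet_derivative ?F (at (snd c p)) = (\<lambda>x. x)"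
    using has_derivative_unique has_derivative_ident by blast
  then show ?thesis by (metis comp_apply)
qed

lemma coord_vec_comps:
  assumes "smooth_atlas B" "d \<in> B" "p \<in> fst d"
  shows "coord_vec B d (comps B d p v) p = v"
  unfolding coord_vec_def comps_def
  using chart_at[OF assms(1)] assms by (intro transition_inverse) auto

lemma linear_comps:
  assumes "smooth_atlas B" "d \<in> B" "p \<in> fst d"
  shows "linear (comps B d p)"
  unfolding comps_def
  using transition_has_derivative[OF assms(1) _ assms(2) _ assms(3)] chart_at[OF assms(1)]
  by (blast intro: has_derivative_linear)

lemma linear_coord_vec:
  assumes "smooth_atlas B" "d \<in> B" "p \<in> fst d"
  shows "linear (\<lambda>u. coord_vec B d u p)"
  unfolding coord_vec_def
  using transition_has_derivative[OF assms(1,2) _ assms(3)] chart_at[OF assms(1)]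
  by (blast intro: has_derivative_linear)

text \<open>This is the matrix of \<open>T\<close> in the chart \<open>d\<close>. For
  \<open>T = J p\<close> its columns are exactly the functions whose smoothness
  \<open>almost_complex\<close> provides.\<close>

lemma comps_endomorphism_expand:
  assumes "smooth_atlas B" "d \<in> B" "p \<in> fst d" "linear T"
  shows "comps B d p (T v) =
    (\<Sum>b\<in>Basis. (comps B d p v \<bullet> b) *\<^sub>R comps B d p (T (coord_vec B d b p)))"
proof -
  have "linear (\<lambda>u. comps B d p (T (coord_vec B d u p)))"
    using linear_compose[OF linear_compose[OF linear_coord_vec[OF assms(1-3)] assms(4)]
        linear_comps[OF assms(1-3)]]
    by (simp add: comp_def)
  from linear_expand[OF this, of "comps B d p v"] show ?thesis
    by (simp add: coord_vec_comps[OF assms(1-3)])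
qed

section \<open>Smoothness of the image of fields and bundles under \<open>J\<close>\<close>

text \<open>In charts, the components of \<open>J X\<close> are sums of products of components of
  \<open>X\<close> with the matrix of \<open>J\<close> composed with the coordinate expression of
  \<open>f\<close>, so the product and composition rules apply.\<close>

lemma almost_complex_smooth_along:
  assumes A: "smooth_atlas A" and B: "smooth_atlas B" and f: "smooth_map A B f"
    and J: "almost_complex B J" and W: "open W" and X: "smooth_along A B f W X"
  shows "smooth_along A B f W (\<lambda>p. J (f p) (X p))"
  unfolding smooth_along_def smooth_on_def
proof (intro ballI allI)
  fix c d k
  assume c: "c \<in> A" and d: "d \<in> B"
  define P where "P = fst c \<inter> W \<inter> f -` fst d"
  \<comment> \<open>\<open>M b\<close> is the column of the matrix of \<open>J\<close> belonging to
    the basis vector \<open>b\<close>, as a function of the coordinates of \<open>d\<close>.\<close>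
  define M where "M b = (\<lambda>p. comps B d p (J p (coord_vec B d b p))) \<circ> chart_inv d" for b
  let ?x = "(\<lambda>p. comps B d (f p) (X p)) \<circ> chart_inv c" and ?f = "snd d \<circ> f \<circ> chart_inv c"
  have cd: "open (fst c)" "open (fst d)" "open (snd d ` fst d)"
    using A B c d unfolding smooth_atlas_def by auto
  have "open (f -` fst d)"
    using f cd(2) open_vimage unfolding smooth_map_def by blast
  then have U: "open (snd c ` P)"
    using cd(1) W unfolding P_def by (intro open_chart_image[OF A c]) auto
  have "Ck_on k (snd c ` P) ?x"
    using X c d unfolding smooth_along_def smooth_on_def P_def by blast
  moreover have "Ck_on k (snd c ` P) (\<lambda>y. M b (?f y))" for b
  proof (rule Ck_on_compose[OF U cd(3), where F = "M b" and G = ?f])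
    show "?f ` snd c ` P \<subseteq> snd d ` fst d"
      using chart_inv_chart[OF A c] unfolding P_def by auto
    show "Ck_on k (snd d ` fst d) (M b)"
      using J d unfolding almost_complex_def smooth_on_def M_def by blast
    have "Ck_on k (snd c ` (fst c \<inter> f -` fst d)) ?f"
      using f c d unfolding smooth_map_def smooth_on_def by blast
    then show "Ck_on k (snd c ` P) ?f"
      by (rule Ck_on_subset) (auto simp: P_def)
  qed
  ultimately have "Ck_on k (snd c ` P) (\<lambda>y. \<Sum>b\<in>Basis. (?x y \<bullet> b) *\<^sub>R M b (?f y))"
    by (intro Ck_on_sum Ck_on_scaleR U Ck_on_bounded_linear[OF _ bounded_linear_inner_left])
  then show "Ck_on k (snd c ` (fst c \<inter> W \<inter> f -` fst d))
      ((\<lambda>p. comps B d (f p) (J (f p) (X p))) \<circ> chart_inv c)"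
    unfolding P_def[symmetric]
  proof (rule Ck_on_cong[OF U, rotated])
    fix y assume "y \<in> snd c ` P"
    then obtain p where p: "p \<in> fst c" "f p \<in> fst d" "y = snd c p"
      unfolding P_def by auto
    have "linear (J (f p))"
      using J unfolding almost_complex_def by blast
    from comps_endomorphism_expand[OF B d p(2) this, of "X p"] p
    show "(\<Sum>b\<in>Basis. (?x y \<bullet> b) *\<^sub>R M b (?f y)) =
        ((\<lambda>p. comps B d (f p) (J (f p) (X p))) \<circ> chart_inv c) y"
      by (simp add: M_def chart_inv_chart[OF A c] chart_inv_chart[OF B d])
  qed
qed

lemma almost_complex_inj:
  assumes "almost_complex B J"
  shows "linear (J p)" "inj (J p)"
  using assms unfolding almost_complex_def by (auto intro!: injI) (metis neg_equal_iff_equal)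

text \<open>\<open>J\<close> carries a local frame to a local frame: linearity preserves the spans
  and injectivity the rank.\<close>

lemma almost_complex_subbundle:
  assumes "smooth_atlas A" "smooth_atlas B" "smooth_map A B f" "almost_complex B J"
    and "subbundle A B f E"
  shows "subbundle A B f (\<lambda>p. J (f p) ` E p)"
proof -
  obtain k where k: "subbundle_of_rank A B f k E"
    using assms(5) unfolding subbundle_def by blast
  have "\<exists>W X. open W \<and> p \<in> W \<and> frame_on A B f W k (\<lambda>p. J (f p) ` E p) X" for p
  proof -
    obtain W X where W: "open W" "p \<in> W" and X: "frame_on A B f W k E X"
      using k unfolding subbundle_of_rank_def by blast
    have "frame_on A B f W k (\<lambda>p. J (f p) ` E p) (\<lambda>i p. J (f p) (X i p))"
      unfolding frame_on_def
    proof (intro conjI allI impI ballI)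
      fix i assume "i < k"
      then show "smooth_along A B f W (\<lambda>p. J (f p) (X i p))"
        using X almost_complex_smooth_along[OF assms(1-4) W(1)] unfolding frame_on_def by blast
    next
      fix q assume q: "q \<in> W"
      note J = almost_complex_inj[OF assms(4), of "f q"]
      show "J (f q) ` E q = span ((\<lambda>i. J (f q) (X i q)) ` {..<k})"
        using X q linear_span_image[OF J(1), of "(\<lambda>i. X i q) ` {..<k}"]
        unfolding frame_on_def image_image by metis
      show "dim (J (f q) ` E q) = k"
        using X q dim_image_eq[OF J(1)] J(2) unfolding frame_on_def
        by (metis inj_on_subset subset_UNIV)
    qed
    then show ?thesis using W by blast
  qed
  then show ?thesis
    unfolding subbundle_def subbundle_of_rank_def by blast
qed

lemma subbundle_subspace:
  assumes "subbundle A B f E"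
  shows "subspace (E p)"
  using assms unfolding subbundle_def subbundle_of_rank_def frame_on_def
  by (metis subspace_span)


section \<open>Lightlike submanifolds\<close>

text \<open>Orthogonality to \<open>L\<close> amounts to \<open>dim L\<close> linear conditions, one
  for each vector of a basis of its span; these are too few to leave only 0 in
  \<open>R\<close>.\<close>

lemma exists_orthogonal_to_smaller_subspace:
  fixes b :: "'e::euclidean_space \<Rightarrow> 'e \<Rightarrow> real"
  assumes "bilinear b" "subspace R" "dim L < dim R"
  shows "\<exists>x\<in>R. x \<noteq> 0 \<and> (\<forall>l\<in>L. b x l = 0)"
proof -
  obtain C where C: "C \<subseteq> L" "independent C" "L \<subseteq> span C" "card C = dim L"
    using basis_exists by blast
  have fin: "finite C"
    using C(2) by (simp add: independent_imp_finite)
  \<comment> \<open>\<open>T\<close> packs the functionals \<open>\<lambda>x. b x u\<close> for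
    \<open>u\<close> in \<open>C\<close> into one linear map, with the values as coefficients of
    independent vectors, so that \<open>T x = 0\<close> means that all of them vanish at
    \<open>x\<close>.\<close>
  define T where "T x = (\<Sum>u\<in>C. b x u *\<^sub>R u)" for x
  have bl: "linear (\<lambda>x. b x u)" "linear (b x)" for x u
    using assms(1) unfolding bilinear_def by auto
  have T: "linear T"
    unfolding T_def
    by (intro linear_compose_sum ballI linearI)
      (auto simp: linear_add[OF bl(1)] linear_cmul[OF bl(1)] scaleR_left_distrib)
  have "T ` R \<subseteq> span C"
    unfolding T_def by (auto intro: span_sum span_scale span_base)
  then have "dim (T ` R) \<le> card C"
    using fin by (rule dim_le_card)
  \<comment> \<open>An injective \<open>T\<close> would preserve the dimension of \<open>R\<close>,
    which exceeds \<open>card C\<close>.\<close>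
  then have "\<not> inj_on T R"
    using dim_image_eq[OF T, of R] assms(2,3) C(4) by (metis leD span_eq_iff)
  then obtain x where x: "x \<in> R" "T x = 0" "x \<noteq> 0"
    using linear_inj_on_iff_eq_0[OF T assms(2)] by blast
  have "b x u = 0" if "u \<in> C" for u
    using C(2) fin x(2) that unfolding T_def independent_explicit by blast
  then have "b x l = 0" if "l \<in> span C" for l
    using linear_eq_0_on_span[OF bl(2)] that by blast
  then show ?thesis
    using x C(3) by blast
qed

text \<open>The condition that the intersection is \<open>{0}\<close> already puts 0 into both
  summands.\<close>

lemma direct_sum_subsets:
  assumes "direct_sum E F G"
  shows "F \<subseteq> E" "G \<subseteq> E"
proof -
  have "0 \<in> F" "0 \<in> G" "E = {x + y | x y. x \<in> F \<and> y \<in> G}"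
    using assms unfolding direct_sum_def by auto
  then show "F \<subseteq> E" "G \<subseteq> E"
    by (auto, (metis add.right_neutral), (metis add.left_neutral))
qed

lemma direct_sum_zero_right:
  assumes "direct_sum E F {0}"
  shows "E = F"
  using assms unfolding direct_sum_def by auto

lemma direct_sum_zero_left:
  assumes "direct_sum E {0} F"
  shows "E = F"
  using assms unfolding direct_sum_def by auto

text \<open>Were \<open>L\<close> a proper subspace of \<open>N\<close>, some \<open>x \<noteq> 0\<close> in \<open>R\<close> would be orthogonal to \<open>L\<close>, and then
  \<open>j x\<close> would lie in the radical of the non-degenerate \<open>ST\<close>.\<close>

lemma transversal_part_eq:
  fixes b :: "'e::euclidean_space \<Rightarrow> 'e \<Rightarrow> real"
  assumes b: "bilinear b" "\<And>u v. b (j u) (j v) = b u v"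
    and j: "linear j" "\<And>v. j (j v) = - v"
    and R: "subspace R" "\<And>x y. x \<in> R \<Longrightarrow> y \<in> R \<Longrightarrow> b x y = 0" "\<And>x s. x \<in> R \<Longrightarrow> s \<in> S \<Longrightarrow> b x s = 0"
    and ST: "nondeg_on b ST" "j ` R \<subseteq> ST" "direct_sum E (j ` R) D'" "orth_sum b ST E D0"
    and L: "orth_sum b (j ` D') L S" "subspace L" "L \<subseteq> N" "subspace N" "dim N = dim R"
  shows "L = N"
proof (rule ccontr)
  assume "L \<noteq> N"
  \<comment> \<open>A subspace \<open>L\<close> of \<open>N\<close> of the same dimension would
    equal \<open>N\<close>, and \<open>dim N = dim R\<close>.\<close>
  then have "dim L < dim R"
    using L by (metis dim_subset order_le_neq_trans subspace_dim_equal order_refl)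
  then obtain x where x: "x \<in> R" "x \<noteq> 0" "\<And>l. l \<in> L \<Longrightarrow> b x l = 0"
    using exists_orthogonal_to_smaller_subspace[OF b(1) R(1)] by blast
  have add: "b u (v + w) = b u v + b u w" and neg: "b (- u) v = - b u v" for u v w
    using b(1) by (auto simp: bilinear_radd bilinear_lneg)
  have E: "j x \<in> E"
    using direct_sum_subsets(1)[OF ST(3)] x(1) by blast
  \<comment> \<open>Invariance of \<open>b\<close> under \<open>j\<close> and
    \<open>j (j x) = - x\<close> give \<open>b (j x) y = - b x (j y)\<close>. Here
    \<open>j y\<close> splits into a part in \<open>L\<close>, orthogonal to \<open>x\<close> by the
    choice of \<open>x\<close>, and a part in \<open>S\<close>, orthogonal to all of
    \<open>R\<close>.\<close>
  have "b (j x) y = 0" if "y \<in> D'" for y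
  proof -
    have "j y \<in> {l + s | l s. l \<in> L \<and> s \<in> S}"
      using L(1) that unfolding orth_sum_def direct_sum_def by (metis imageI)
    then obtain l s where "l \<in> L" "s \<in> S" "j y = l + s"
      by blast
    then have "b x (j y) = 0"
      using x R(3) by (simp add: add)
    then show ?thesis
      using b(2)[of "j x" y] j(2)[of x] by (simp add: neg)
  qed
  \<comment> \<open>By invariance this is the total isotropy of \<open>R\<close>.\<close>
  moreover have "b (j x) y = 0" if "y \<in> j ` R" for y
    using that b(2) R(2) x(1) by auto
  ultimately have "b (j x) y = 0" if "y \<in> E" for y
    using that ST(3) unfolding direct_sum_def by (auto simp: add)
  moreover have "b (j x) y = 0" if "y \<in> D0" for y
    using that ST(4) E unfolding orth_sum_def by blast
  ultimately have "b (j x) y = 0" if "y \<in> ST" for y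
    using that ST(4) unfolding orth_sum_def direct_sum_def by (auto simp: add)
  then have "j x = 0"
    using ST(1,2) x(1) unfolding nondeg_on_def by blast
  then show False
    using j(2)[of x] x(2) linear_0[OF j(1)] by simp
qed

section \<open>Fibres of the bundles of a lightlike submanifold\<close>

lemma lightlike_submanifold_Int:
  assumes "lightlike_submanifold A B g f r STM STMperp ltr"
  shows "STM p \<subseteq> TM A B f p" "STM p \<inter> Rad A B g f p = {0}"
    "TM A B f p \<inter> STMperp p = {0}"
proof -
  have o: "orth_sum (g (f p)) (TM A B f p) (STM p) (Rad A B g f p)"
    "orth_sum (g (f p)) (TM_perp A B g f p) (STMperp p) (Rad A B g f p)"
    using assms unfolding lightlike_submanifold_def by auto
  then have d: "direct_sum (TM A B f p) (STM p) (Rad A B g f p)"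
    "direct_sum (TM_perp A B g f p) (STMperp p) (Rad A B g f p)"
    unfolding orth_sum_def by auto
  show S: "STM p \<subseteq> TM A B f p" "STM p \<inter> Rad A B g f p = {0}"
    using direct_sum_subsets(1)[OF d(1)] d(1) by (simp_all add: direct_sum_def)
  have "STMperp p \<subseteq> TM_perp A B g f p" "STMperp p \<inter> Rad A B g f p = {0}"
    using direct_sum_subsets(1)[OF d(2)] d(2) by (simp_all add: direct_sum_def)
  \<comment> \<open>The inclusion of the intersection in \<open>{0}\<close> comes from
    \<open>TM \<inter> STMperp \<subseteq> Rad\<close>; this gives the reverse inclusion.\<close>
  moreover have "0 \<in> TM A B f p"
    using S by blast
  ultimately show "TM A B f p \<inter> STMperp p = {0}"
    unfolding Rad_def by blast
qed

text \<open>Both "only if" directions end here: the image under \<open>J\<close> of the summand in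
  question is shown to lie in two bundles that meet only in 0.\<close>

lemma image_subset_zero:
  assumes "linear j" "inj j" "subspace D" "j ` D \<subseteq> {0}"
  shows "D = {0}"
proof -
  have "x = 0" if "x \<in> D" for x
    using that assms linear_injective_0 by blast
  then show ?thesis
    using subspace_0[OF assms(3)] by blast
qed

text \<open>Both ranks are \<open>r\<close>. This is the dimension count that turns the inclusion of
  \<open>L1\<close> in \<open>ltr\<close> into equality.\<close>

lemma lightlike_submanifold_transversal:
  assumes "lightlike_submanifold A B g f r STM STMperp ltr"
  shows "subspace (ltr p)" "dim (ltr p) = dim (Rad A B g f p)"
proof -
  have l: "subbundle_of_rank A B f r ltr" "dim (Rad A B g f p) = r"
    using assms unfolding lightlike_submanifold_def lightlike_transversal_def by auto
  from l(1) show "subspace (ltr p)"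
    by (intro subbundle_subspace) (auto simp: subbundle_def)
  show "dim (ltr p) = dim (Rad A B g f p)"
    using l unfolding subbundle_of_rank_def frame_on_def by metis
qed

section \<open>Comparison of the classes of submanifolds\<close>

text \<open>Once \<open>Rad\<close> is \<open>D1\<close>, the bundles \<open>D0\<close>,
  \<open>D'\<close> and \<open>S\<close> of the STCR structure serve unchanged as the CR data, with
  \<open>L1\<close> identified with \<open>ltr\<close> by
  \<open>transversal_part_eq\<close>.\<close>

lemma stcr_lightlike_cr_lightlike:
  fixes A :: "('m::{t2_space,second_countable_topology}, 'h::euclidean_space) chart set"
    and B :: "('p::{t2_space,second_countable_topology}, 'e::euclidean_space) chart set"
  assumes K: "indefinite_kaehler B g J q"
    and M: "stcr_lightlike A B g J f r STM STMperp ltr D1 D2"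
    and D2: "\<And>p. D2 p = {0}"
  shows "cr_lightlike A B g J f r STM STMperp ltr"
proof -
  have ll: "lightlike_submanifold A B g f r STM STMperp ltr"
    and D1: "subbundle A B f D1" "\<And>p. J (f p) ` D1 p \<subseteq> STM p"
    using M unfolding stcr_lightlike_def by auto
  have R: "Rad A B g f = D1"
    using M direct_sum_zero_right D2 unfolding stcr_lightlike_def by (metis ext)
  obtain D0 D' L1 S where H: "\<forall>p. D0 p \<subseteq> STM p \<and> D' p \<subseteq> STM p \<and> L1 p \<subseteq> ltr p \<and> S p \<subseteq> STMperp p \<and>
             nondeg_on (g (f p)) (D0 p) \<and>
             (\<exists>E. direct_sum E (J (f p) ` D1 p) (D' p) \<and> orth_sum (g (f p)) (STM p) E (D0 p)) \<and>
             J (f p) ` D0 p = D0 p \<and> orth_sum (g (f p)) (J (f p) ` D' p) (L1 p) (S p)"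
    and bundles: "subbundle A B f D0" "subbundle A B f D'" "subbundle A B f L1" "subbundle A B f S"
    using M unfolding stcr_lightlike_def by (elim conjE exE) (rule that; assumption)
  then have sub: "\<And>p. D0 p \<subseteq> STM p \<and> D' p \<subseteq> STM p \<and> S p \<subseteq> STMperp p" "\<And>p. L1 p \<subseteq> ltr p"
    and D0: "\<And>p. nondeg_on (g (f p)) (D0 p) \<and> J (f p) ` D0 p = D0 p"
    and E: "\<And>p. \<exists>E. direct_sum E (J (f p) ` D1 p) (D' p) \<and> orth_sum (g (f p)) (STM p) E (D0 p)"
    and L1: "\<And>p. orth_sum (g (f p)) (J (f p) ` D' p) (L1 p) (S p)"
    by simp_all
  have J: "almost_complex B J" "\<And>p u v. g p (J p u) (J p v) = g p u v"
    and g: "\<And>p. bilinear (g p)" "\<And>p u v. g p u v = g p v u"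
    and atlas: "smooth_atlas B"
    using K unfolding indefinite_kaehler_def semi_riemannian_def by auto
  have f: "smooth_atlas A" "smooth_map A B f"
    using ll unfolding lightlike_submanifold_def submanifold_def by auto
  note Int = lightlike_submanifold_Int[OF ll]
  have "L1 p = ltr p" for p
  proof -
    obtain E where E: "direct_sum E (J (f p) ` D1 p) (D' p)"
        "orth_sum (g (f p)) (STM p) E (D0 p)"
      using E by blast
    show ?thesis
    proof (rule transversal_part_eq[OF g(1)[of "f p"] _ almost_complex_inj(1)[OF J(1)]])
      \<comment> \<open>The radical is totally isotropic, being both tangent and normal.\<close>
      show "g (f p) x y = 0" if "x \<in> D1 p" "y \<in> D1 p" for x y
        using that unfolding R[symmetric] Rad_def TM_perp_def orth_compl_def by blast
      \<comment> \<open>The splitting of the normal bundle makes \<open>STMperp\<close>, hence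
        \<open>S\<close>, orthogonal to the radical; symmetry of the metric exchanges the
        arguments.\<close>
      have "orth_sum (g (f p)) (TM_perp A B g f p) (STMperp p) (Rad A B g f p)"
        using ll unfolding lightlike_submanifold_def by blast
      then show "g (f p) x s = 0" if "x \<in> D1 p" "s \<in> S p" for x s
        using that sub(1) g(2) unfolding orth_sum_def R by (metis subsetD)
      show "nondeg_on (g (f p)) (STM p)"
        using ll unfolding lightlike_submanifold_def by blast
      show "J (f p) (J (f p) v) = - v" for v
        using J(1) unfolding almost_complex_def by blast
      show "subspace (ltr p)" "dim (ltr p) = dim (D1 p)"
        using lightlike_submanifold_transversal[OF ll] R by metis+
    qed (use J D1 E L1 sub subbundle_subspace[OF D1(1)] subbundle_subspace[OF bundles(3)] in auto)
  qed
  then have "orth_sum (g (f p)) (J (f p) ` D' p) (ltr p) (S p)" for p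
    using L1 by metis
  \<comment> \<open>\<open>J D1\<close> lies in \<open>STM\<close>, which is tangent and meets the
    radical only in 0.\<close>
  moreover have "J (f p) ` D1 p \<subseteq> TM A B f p \<and> D1 p \<inter> J (f p) ` D1 p = {0}" for p
  proof -
    have "0 \<in> D1 p" "J (f p) 0 = 0"
      using subspace_0[OF subbundle_subspace[OF D1(1)]]
        linear_0[OF almost_complex_inj(1)[OF J(1)]] by auto
    then have "0 \<in> D1 p \<inter> J (f p) ` D1 p"
      by (metis IntI imageI)
    then show ?thesis
      using D1(2)[of p] Int(1,2)[of p] R by auto
  qed
  ultimately show ?thesis
    using ll almost_complex_subbundle[OF f(1) atlas f(2) J(1) D1(1)] bundles sub(1) D0 E
    unfolding cr_lightlike_def R
    by - (intro conjI; (rule exI[of _ D0], rule exI[of _ D'], rule exI[of _ S])?; simp)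
qed

theorem proposition3p1:
  fixes A :: "('m::{t2_space,second_countable_topology}, 'h::euclidean_space) chart set"
    and B :: "('p::{t2_space,second_countable_topology}, 'e::euclidean_space) chart set"
    and g :: "'p \<Rightarrow> 'e \<Rightarrow> 'e \<Rightarrow> real" and J :: "'p \<Rightarrow> 'e \<Rightarrow> 'e" and q :: nat
    and f :: "'m \<Rightarrow> 'p" and r :: nat
    and STM STMperp ltr D1 D2 :: "'m \<Rightarrow> 'e set"
  assumes "indefinite_kaehler B g J q"
    and "stcr_lightlike A B g J f r STM STMperp ltr D1 D2"
  shows "(cr_lightlike A B g J f r STM STMperp ltr \<longleftrightarrow> (\<forall>p. D2 p = {0})) \<and>
         (screen_transversal_lightlike A B g J f r STM STMperp ltr \<longleftrightarrow> (\<forall>p. D1 p = {0}))"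
proof (intro conjI iffI allI)
  have ll: "lightlike_submanifold A B g f r STM STMperp ltr"
    and D: "subbundle A B f D1" "subbundle A B f D2"
    and sum: "\<And>p. direct_sum (Rad A B g f p) (D1 p) (D2 p)"
    and JD: "\<And>p. J (f p) ` D1 p \<subseteq> STM p" "\<And>p. J (f p) ` D2 p \<subseteq> STMperp p"
    using assms(2) unfolding stcr_lightlike_def by auto
  have "almost_complex B J"
    using assms(1) unfolding indefinite_kaehler_def by blast
  note J = almost_complex_inj[OF this]
  note Int = lightlike_submanifold_Int[OF ll]
  \<comment> \<open>The CR condition makes \<open>J D2\<close> tangent, while the STCR structure
    places it in \<open>STMperp\<close>.\<close>
  show "D2 p = {0}" if "cr_lightlike A B g J f r STM STMperp ltr" for p
  proof (rule image_subset_zero[OF J subbundle_subspace[OF D(2)]])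
    have "J (f p) ` Rad A B g f p \<subseteq> TM A B f p"
      using that unfolding cr_lightlike_def by blast
    then show "J (f p) ` D2 p \<subseteq> {0}"
      using direct_sum_subsets(2)[OF sum[of p]] JD(2)[of p] Int(3)[of p] by blast
  qed
  \<comment> \<open>The roles are reversed: \<open>J D1\<close> is tangent by the STCR structure and
    lies in \<open>STMperp\<close> by screen transversality.\<close>
  show "D1 p = {0}" if "screen_transversal_lightlike A B g J f r STM STMperp ltr" for p
  proof (rule image_subset_zero[OF J subbundle_subspace[OF D(1)]])
    have "J (f p) ` Rad A B g f p \<subseteq> STMperp p"
      using that unfolding screen_transversal_lightlike_def by blast
    then show "J (f p) ` D1 p \<subseteq> {0}"
      using direct_sum_subsets(1)[OF sum[of p]] JD(1)[of p] Int(1,3)[of p] by blast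
  qed
  show "cr_lightlike A B g J f r STM STMperp ltr" if "\<forall>p. D2 p = {0}"
    using stcr_lightlike_cr_lightlike[OF assms] that by blast
  \<comment> \<open>With \<open>D1\<close> zero the radical is \<open>D2\<close>, so the STCR
    inclusion of \<open>J D2\<close> in \<open>STMperp\<close> is the claim.\<close>
  show "screen_transversal_lightlike A B g J f r STM STMperp ltr" if "\<forall>p. D1 p = {0}"
    using ll JD(2) sum that direct_sum_zero_left unfolding screen_transversal_lightlike_def
    by metis
qed

end
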